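(* Let $\rho_{\bar i}\in\mathcal S(\mathcal H_{\bar i})$ be a pure state relative to frame $R_i$ in orientation $g_i$. Let $\rho_{\bar j}=\hat V_{i\to j}^{g_i,g_j}(\rho_{\bar i})\in\mathcal S(\mathcal H_{\bar j})$ be the corresponding pure state relative to frame $R_j$ in orientation $g_j$. Then the $S$-subsystem states $\rho_{S|R_i}=\mathrm{Tr}_j(\rho_{\bar i})$ and $\rho_{S|R_j}=\mathrm{Tr}_i(\rho_{\bar j})$ in the two frame perspectives are unitarily related, i.e. there exists a unitary $Z_S$ on $\mathcal H_S$ such that $$\rho_{S|R_j}=Z_S^\dagger\,\rho_{S|R_i}\,Z_S,$$ if and only if $\rho_{\bar i}\in\mathcal A_{\bar i}^{X}$ with $X=Y_j\otimes Z_S$ for some local unitary $Y_j$ on $\mathcal H_j$, i.e. $$\mathbf U_{\bar i}^{g_i,g_j}\rho_{\bar i}\,(\mathbf U_{\bar i}^{g_i,g_j})^\dagger=(Y_j^\dagger\otimes Z_S^\dagger)\,\rho_{\bar i}\,(Y_j\otimes Z_S).$$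
   Context: $\mathcal G$ is a finite abelian group, $\mathcal G\neq\{e\}$. For $i=1,2$ (two ideal quantum reference frames $R_1,R_2$), $\mathcal H_i=\ell^2(\mathcal G)$ has orthonormal basis $\{|g\rangle_i\}_{g\in\mathcal G}$. $\mathcal H_S$ is a (possibly infinite-dimensional) complex Hilbert space carrying a unitary representation $g\mapsto U_S^g$ of $\mathcal G$. For $i\neq j$ in $\{1,2\}$, $\mathcal H_{\bar i}=\mathcal H_j\otimes\mathcal H_S$ (the description of $R_j$ and $S$ relative to $R_i$), $\mathcal A_{\bar i}$ is the algebra of (bounded) linear operators on it, and $\mathcal S(\cdot)$ denotes the set of density operators. For a unitary $W$ write $\hat W(A)=WAW^\dagger$ and $\hat W^\dagger(A)=W^\dagger AW$. The frame change is the unitary $V_{i\to j}^{g_i,g_j}=\sum_{g\in\mathcal G}|gg_i\rangle_i\otimes\langle g_jg^{-1}|_j\otimes U_S^g:\mathcal H_{\bar i}\to\mathcal H_{\bar j}$. The unitary $\mathbf U_{\bar i}^{g_i,g_j}=\sum_{g\in\mathcal G}|g_ig\rangle\langle g_jg^{-1}|_j\otimes U_S^g$ on $\mathcal H_{\bar i}$ equals $V_{i\to j}^{g_i,g_j}$ followed by the frame swap $\sum_g|g\rangle_j\otimes\langle g|_i\otimes\mathbf 1_S$. For a bilocal unitary $X=Y_j\otimes Z_S$, $\mathcal A_{\bar i}^{X}=\{f\in\mathcal A_{\bar i}:\hat{\mathbf U}_{\bar i}^{g_i,g_j}(f)=\hat X^\dagger(f)\}$. *)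

theory Defs
  imports "HOL-Analysis.Analysis"
begin

section \<open>Complex Hilbert spaces\<close>

text \<open>The inner product is conjugate-linear in its first argument.\<close>

class chilbert_space = banach +
  fixes scaleC :: "complex \<Rightarrow> 'a \<Rightarrow> 'a" (infixr "*\<^sub>C" 75)
    and cinner :: "'a \<Rightarrow> 'a \<Rightarrow> complex"
  assumes scaleC_add_right: "c *\<^sub>C (x + y) = c *\<^sub>C x + c *\<^sub>C y"
    and scaleC_add_left: "(c + d) *\<^sub>C x = c *\<^sub>C x + d *\<^sub>C x"
    and scaleC_scaleC: "c *\<^sub>C d *\<^sub>C x = (c * d) *\<^sub>C x"
    and scaleR_scaleC: "scaleR r x = of_real r *\<^sub>C x"
    and cinner_commute: "cinner x y = cnj (cinner y x)"
    and cinner_add_right: "cinner x (y + z) = cinner x y + cinner x z"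
    and cinner_scaleC_right: "cinner x (c *\<^sub>C y) = c * cinner x y"
    and cinner_self: "cinner x x = of_real ((norm x)\<^sup>2)"

instantiation complex :: chilbert_space
begin
definition scaleC_complex :: "complex \<Rightarrow> complex \<Rightarrow> complex"
  where "scaleC_complex c x = c * x"
definition cinner_complex :: "complex \<Rightarrow> complex \<Rightarrow> complex"
  where "cinner_complex x y = cnj x * y"
instance
proof
  fix c d :: complex and r :: real and x y z :: complex
  show "c *\<^sub>C (x + y) = c *\<^sub>C x + c *\<^sub>C y" "(c + d) *\<^sub>C x = c *\<^sub>C x + d *\<^sub>C x"
    "c *\<^sub>C d *\<^sub>C x = (c * d) *\<^sub>C x" "scaleR r x = of_real r *\<^sub>C x"
    by (simp_all add: scaleC_complex_def distrib_left distrib_right mult.assoc scaleR_conv_of_real)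
  show "cinner x y = cnj (cinner y x)"
    by (simp add: cinner_complex_def mult.commute)
  show "cinner x (y + z) = cinner x y + cinner x z"
    by (simp add: cinner_complex_def distrib_left)
  show "cinner x (c *\<^sub>C y) = c * cinner x y"
    by (simp add: cinner_complex_def scaleC_complex_def)
  show "cinner x x = of_real ((norm x)\<^sup>2)"
    unfolding cinner_complex_def complex_norm_square by (rule mult.commute)
qed
end

text \<open>The Hilbert direct sum; its norm is the library's Euclidean norm on vectors.\<close>

instantiation vec :: (chilbert_space, finite) chilbert_space
begin
definition scaleC_vec :: "complex \<Rightarrow> 'a ^ 'b \<Rightarrow> 'a ^ 'b"
  where "scaleC_vec c x = (\<chi> a. c *\<^sub>C (x $ a))"
definition cinner_vec :: "'a ^ 'b \<Rightarrow> 'a ^ 'b \<Rightarrow> complex"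
  where "cinner_vec x y = (\<Sum>a\<in>UNIV. cinner (x $ a) (y $ a))"
instance
proof
  fix c d :: complex and r :: real and x y z :: "'a ^ 'b"
  show "c *\<^sub>C (x + y) = c *\<^sub>C x + c *\<^sub>C y" "(c + d) *\<^sub>C x = c *\<^sub>C x + d *\<^sub>C x"
    "c *\<^sub>C d *\<^sub>C x = (c * d) *\<^sub>C x" "scaleR r x = of_real r *\<^sub>C x"
    by (simp_all add: vec_eq_iff scaleC_vec_def scaleC_add_right scaleC_add_left
        scaleC_scaleC scaleR_scaleC)
  show "cinner x y = cnj (cinner y x)"
    unfolding cinner_vec_def cnj_sum by (intro sum.cong refl cinner_commute)
  show "cinner x (y + z) = cinner x y + cinner x z"
    by (simp add: cinner_vec_def cinner_add_right sum.distrib)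
  show "cinner x (c *\<^sub>C y) = c * cinner x y"
    by (simp add: cinner_vec_def scaleC_vec_def cinner_scaleC_right sum_distrib_left)
  show "cinner x x = of_real ((norm x)\<^sup>2)"
    by (simp add: cinner_vec_def cinner_self norm_vec_def L2_set_def sum_nonneg)
qed
end

section \<open>Operators\<close>

definition bounded_clinear :: "('a::chilbert_space \<Rightarrow> 'b::chilbert_space) \<Rightarrow> bool"
  where "bounded_clinear A \<longleftrightarrow> bounded_linear A \<and> (\<forall>c x. A (c *\<^sub>C x) = c *\<^sub>C A x)"

text \<open>Every bounded operator between Hilbert spaces has exactly one adjoint.\<close>

definition cadjoint :: "('a::chilbert_space \<Rightarrow> 'b::chilbert_space) \<Rightarrow> 'b \<Rightarrow> 'a"
  where "cadjoint A = (THE B. \<forall>x y. cinner (B y) x = cinner y (A x))"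

definition unitary :: "('a::chilbert_space \<Rightarrow> 'b::chilbert_space) \<Rightarrow> bool"
  where "unitary W \<longleftrightarrow>
    bounded_clinear W \<and> surj W \<and> (\<forall>x y. cinner (W x) (W y) = cinner x y)"

text \<open>\<open>A \<mapsto> W A W\<^sup>\<dagger>\<close> and \<open>A \<mapsto> W\<^sup>\<dagger> A W\<close>.\<close>

definition conj_by :: "('a::chilbert_space \<Rightarrow> 'b::chilbert_space) \<Rightarrow> ('a \<Rightarrow> 'a) \<Rightarrow> 'b \<Rightarrow> 'b"
  where "conj_by W A = W \<circ> A \<circ> cadjoint W"

definition conj_by_adj :: "('a::chilbert_space \<Rightarrow> 'b::chilbert_space) \<Rightarrow> ('b \<Rightarrow> 'b) \<Rightarrow> 'a \<Rightarrow> 'a"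
  where "conj_by_adj W A = cadjoint W \<circ> A \<circ> W"

text \<open>The rank-one operator \<open>|x\<rangle>\<langle>y|\<close>.\<close>

definition outer :: "'b::chilbert_space \<Rightarrow> 'a::chilbert_space \<Rightarrow> 'a \<Rightarrow> 'b"
  where "outer x y = (\<lambda>z. cinner y z *\<^sub>C x)"

definition orthonormal_basis :: "'a::chilbert_space set \<Rightarrow> bool"
  where "orthonormal_basis B \<longleftrightarrow>
    (\<forall>e\<in>B. \<forall>f\<in>B. cinner e f = (if e = f then 1 else 0)) \<and>
    (\<forall>x. (\<forall>e\<in>B. cinner e x = 0) \<longrightarrow> x = 0)"

text \<open>For positive operators the trace does not depend on the orthonormal basis.\<close>

definition density_operators :: "('a::chilbert_space \<Rightarrow> 'a) set"
  where "density_operators = {\<rho>. bounded_clinear \<rho> \<and>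
    (\<forall>x. cinner x (\<rho> x) \<in> \<real>\<^sub>\<ge>\<^sub>0) \<and>
    (\<exists>B. orthonormal_basis B \<and> ((\<lambda>e. cinner e (\<rho> e)) has_sum 1) B)}"

definition pure_state :: "('a::chilbert_space \<Rightarrow> 'a) \<Rightarrow> bool"
  where "pure_state \<rho> \<longleftrightarrow> \<rho> \<in> density_operators \<and> (\<exists>\<psi>. norm \<psi> = 1 \<and> \<rho> = outer \<psi> \<psi>)"

section \<open>Tensor products with a finite-dimensional factor\<close>

text \<open>
  For a finite index set \<open>A\<close> and a Hilbert space \<open>H\<close>, the tensor product of \<open>\<ell>\<^sup>2(A)\<close> and \<open>H\<close> is
  modelled as the space of \<open>H\<close>-valued vectors indexed by \<open>A\<close>: the component at \<open>a\<close> is the image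
  under \<open>\<langle>a| \<otimes> 1\<close>.
\<close>

definition tensor_vec :: "complex ^ 'a \<Rightarrow> 's \<Rightarrow> 's::chilbert_space ^ 'a" (infixr "\<otimes>\<^sub>v" 70)
  where "\<phi> \<otimes>\<^sub>v \<psi> = (\<chi> a. (\<phi> $ a) *\<^sub>C \<psi>)"

definition tensor_op :: "(complex ^ 'a \<Rightarrow> complex ^ 'b) \<Rightarrow> ('s \<Rightarrow> 't) \<Rightarrow>
    's::chilbert_space ^ 'a \<Rightarrow> 't::chilbert_space ^ 'b" (infixr "\<otimes>\<^sub>o" 70)
  where "A \<otimes>\<^sub>o B = (\<lambda>\<Psi>. \<Sum>a\<in>UNIV. A (axis a 1) \<otimes>\<^sub>v B (\<Psi> $ a))"

definition partial_trace ::
    "('s::chilbert_space ^ 'a \<Rightarrow> 's ^ 'a) \<Rightarrow> 's \<Rightarrow> 's"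
  where "partial_trace A = (\<lambda>\<psi>. \<Sum>a\<in>UNIV. A (axis a 1 \<otimes>\<^sub>v \<psi>) $ a)"

section \<open>Ideal quantum reference frames\<close>

text \<open>
  The group is written additively. The phantom parameter \<open>'r\<close> names the frame, so that the spaces
  of the two frames, both copies of \<open>\<ell>\<^sup>2\<close> of the group, have different types.
\<close>

datatype ('r, 'g) orientation = Orientation (orient: 'g)

instance orientation :: (type, finite) finite
proof
  have "(UNIV :: ('a, 'b::finite) orientation set) = range Orientation"
    by (metis orientation.exhaust surjI)
  then show "finite (UNIV :: ('a, 'b) orientation set)"
    by (metis finite finite_imageI)
qed

type_synonym ('r, 'g) frame_space = "(complex, ('r, 'g) orientation) vec"
type_synonym ('r, 'g, 's) frame_system_space = "('s, ('r, 'g) orientation) vec"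

definition ket :: "'g \<Rightarrow> ('r, 'g::finite) frame_space"
  where "ket g = axis (Orientation g) 1"

definition unitary_rep :: "('g::ab_group_add \<Rightarrow> 's::chilbert_space \<Rightarrow> 's) \<Rightarrow> bool"
  where "unitary_rep U \<longleftrightarrow>
    (\<forall>g. unitary (U g)) \<and> U 0 = id \<and> (\<forall>g h. U (g + h) = U g \<circ> U h)"

text \<open>
  The space \<open>('j, 'g, 's) frame_system_space\<close> is the description of frame \<open>'j\<close> and the system
  relative to frame \<open>'i\<close>. The types of \<open>frame_change\<close> and \<open>frame_swap\<close> fix which frame each ket
  and bra belongs to.
\<close>

definition frame_change :: "('g::{finite, ab_group_add} \<Rightarrow> 's \<Rightarrow> 's) \<Rightarrow> 'g \<Rightarrow> 'g \<Rightarrow>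
    ('j, 'g, 's::chilbert_space) frame_system_space \<Rightarrow> ('i, 'g, 's) frame_system_space"
  where "frame_change U g\<^sub>i g\<^sub>j =
    (\<lambda>\<Psi>. \<Sum>g\<in>UNIV. (outer (ket (g + g\<^sub>i)) (ket (g\<^sub>j - g)) \<otimes>\<^sub>o U g) \<Psi>)"

definition frame_swap ::
    "('i, 'g::{finite, ab_group_add}, 's::chilbert_space) frame_system_space \<Rightarrow>
     ('j, 'g, 's) frame_system_space"
  where "frame_swap = (\<lambda>\<Psi>. \<Sum>g\<in>UNIV. (outer (ket g) (ket g) \<otimes>\<^sub>o id) \<Psi>)"

definition frame_unitary :: "('g::{finite, ab_group_add} \<Rightarrow> 's \<Rightarrow> 's) \<Rightarrow> 'g \<Rightarrow> 'g \<Rightarrow>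
    ('j, 'g, 's::chilbert_space) frame_system_space \<Rightarrow> ('j, 'g, 's) frame_system_space"
  where "frame_unitary U g\<^sub>i g\<^sub>j =
    (\<lambda>\<Psi>. \<Sum>g\<in>UNIV. (outer (ket (g\<^sub>i + g)) (ket (g\<^sub>j - g)) \<otimes>\<^sub>o U g) \<Psi>)"

definition invariant_subalgebra :: "('g::{finite, ab_group_add} \<Rightarrow> 's \<Rightarrow> 's) \<Rightarrow> 'g \<Rightarrow> 'g \<Rightarrow>
    (('j, 'g, 's::chilbert_space) frame_system_space \<Rightarrow> ('j, 'g, 's) frame_system_space) \<Rightarrow>
    (('j, 'g, 's) frame_system_space \<Rightarrow> ('j, 'g, 's) frame_system_space) set"
  where "invariant_subalgebra U g\<^sub>i g\<^sub>j X =
    {f. bounded_clinear f \<and> conj_by (frame_unitary U g\<^sub>i g\<^sub>j) f = conj_by_adj X f}"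

section \<open>Basic facts\<close>

lemma scaleC_zero_left [simp]: "0 *\<^sub>C (x :: 'a::chilbert_space) = 0"
  using scaleC_add_left[of 0 0 x] by simp

lemma scaleC_zero_right [simp]: "c *\<^sub>C (0 :: 'a::chilbert_space) = 0"
  using scaleC_add_right[of c 0 0] by simp

lemma scaleC_one [simp]: "1 *\<^sub>C (x :: 'a::chilbert_space) = x"
  using scaleR_scaleC[of 1 x] by simp

lemma scaleC_sum_left: "(\<Sum>i\<in>I. f i) *\<^sub>C (x :: 'a::chilbert_space) = (\<Sum>i\<in>I. f i *\<^sub>C x)"
  by (induction I rule: infinite_finite_induct) (simp_all add: scaleC_add_left)

lemma cinner_ext:
  assumes "\<And>z :: 'a::chilbert_space. cinner x z = cinner y z"
  shows "x = y"
proof -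
  have *: "cinner (x - y + y) z = cinner (x - y) z + cinner y z" for z
    by (metis cinner_add_right cinner_commute complex_cnj_add)
  have "cinner (x - y) (x - y) = 0"
    using *[of "x - y"] assms[of "x - y"] by simp
  then show ?thesis
    by (simp add: cinner_self)
qed

lemma cadjoint_eqI:
  assumes "\<And>x y. cinner (B y) x = cinner y (A x)"
  shows "cadjoint A = B"
  unfolding cadjoint_def
proof (rule the_equality)
  fix C assume C: "\<forall>x y. cinner (C y) x = cinner y (A x)"
  show "C = B"
  proof
    fix y
    show "C y = B y"
      by (rule cinner_ext) (simp add: C assms)
  qed
qed (simp add: assms)

lemma unitary_inj:
  assumes "unitary W"
  shows "inj W"
proof (rule injI)
  fix x y assume "W x = W y"
  then have "cinner x z = cinner y z" for z
    using assms unfolding unitary_def by metis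
  then show "x = y"
    by (rule cinner_ext)
qed

lemma cinner_inv_unitary_left:
  assumes "unitary W"
  shows "cinner (inv W y) x = cinner y (W x)"
proof -
  have "cinner (inv W y) x = cinner (W (inv W y)) (W x)"
    using assms by (simp add: unitary_def)
  also have "W (inv W y) = y"
    using assms by (simp add: unitary_def surj_f_inv_f)
  finally show ?thesis .
qed

lemma cadjoint_unitary:
  assumes "unitary W"
  shows "cadjoint W = inv W"
  using cinner_inv_unitary_left[OF assms] by (rule cadjoint_eqI)

lemma cinner_cadjoint_left:
  assumes "unitary W"
  shows "cinner (cadjoint W y) x = cinner y (W x)"
  using cinner_inv_unitary_left[OF assms] by (simp add: cadjoint_unitary[OF assms])

lemma tensor_vec_nth [simp]: "(\<phi> \<otimes>\<^sub>v \<psi>) $ a = (\<phi> $ a) *\<^sub>C \<psi>"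
  by (simp add: tensor_vec_def)

lemma tensor_op_tensor_vec:
  assumes "bounded_clinear A" and "bounded_clinear B"
  shows "(A \<otimes>\<^sub>o B) (\<phi> \<otimes>\<^sub>v \<psi>) = A \<phi> \<otimes>\<^sub>v B \<psi>"
proof -
  interpret A: bounded_linear A
    using assms(1) by (simp add: bounded_clinear_def)
  have "\<phi> = (\<Sum>a\<in>UNIV. (\<phi> $ a) *\<^sub>C axis a 1)"
    by (simp add: vec_eq_iff scaleC_vec_def scaleC_complex_def axis_def if_distrib sum.delta
        cong: if_cong)
  then have "A \<phi> = A (\<Sum>a\<in>UNIV. (\<phi> $ a) *\<^sub>C axis a 1)"
    by (rule arg_cong)
  also have "\<dots> = (\<Sum>a\<in>UNIV. (\<phi> $ a) *\<^sub>C A (axis a 1))"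
    using assms(1) by (simp add: A.sum bounded_clinear_def)
  finally have A: "A \<phi> = (\<Sum>a\<in>UNIV. (\<phi> $ a) *\<^sub>C A (axis a 1))" .
  show ?thesis
    using assms(2)
    by (simp add: vec_eq_iff tensor_op_def A bounded_clinear_def scaleC_sum_left
        scaleC_vec_def scaleC_complex_def scaleC_scaleC mult.commute)
qed

lemma cinner_axis_left: "cinner (axis a 1) \<phi> = \<phi> $ a" for \<phi> :: "complex ^ 'a"
proof -
  have "cinner (axis a 1) \<phi> = (\<Sum>b\<in>UNIV. if b = a then \<phi> $ b else 0)"
    unfolding cinner_vec_def by (rule sum.cong) (auto simp: cinner_complex_def axis_def)
  then show ?thesis
    by simp
qed

lemma cinner_axis_right: "cinner \<phi> (axis a 1) = cnj (\<phi> $ a)" for \<phi> :: "complex ^ 'a"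
  using cinner_commute[of \<phi> "axis a 1"] by (simp add: cinner_axis_left)

lemma cinner_sum_right:
  "cinner (x :: 'a::chilbert_space) (\<Sum>i\<in>I. f i) = (\<Sum>i\<in>I. cinner x (f i))"
proof -
  have "cinner x 0 = 0"
    using cinner_add_right[of x 0 0] by simp
  then show ?thesis
    by (induction I rule: infinite_finite_induct) (simp_all add: cinner_add_right)
qed

lemma cinner_sum_left:
  "cinner (\<Sum>i\<in>I. f i) (x :: 'a::chilbert_space) = (\<Sum>i\<in>I. cinner (f i) x)"
  unfolding cinner_commute[of _ x] cinner_sum_right cnj_sum ..

lemma cinner_scaleC_left: "cinner (c *\<^sub>C x) (y :: 'a::chilbert_space) = cnj c * cinner x y"
  using cinner_commute[of "c *\<^sub>C x" y] cinner_commute[of x y] by (simp add: cinner_scaleC_right)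

lemma cadjoint_tensor_op:
  assumes "unitary Y" and "unitary Z"
  shows "cadjoint (Y \<otimes>\<^sub>o Z) = cadjoint Y \<otimes>\<^sub>o cadjoint Z"
proof (rule cadjoint_eqI)
  fix \<Psi> \<Phi>
  have Y: "cnj (cadjoint Y (axis a 1) $ b) = Y (axis b 1) $ a" for a b
    using cinner_cadjoint_left[OF assms(1), of "axis a 1" "axis b 1"]
    by (simp add: cinner_axis_left cinner_axis_right)
  have "cinner ((cadjoint Y \<otimes>\<^sub>o cadjoint Z) \<Phi>) \<Psi> =
      (\<Sum>b\<in>UNIV. \<Sum>a\<in>UNIV. Y (axis b 1) $ a * cinner (\<Phi> $ a) (Z (\<Psi> $ b)))"
    by (simp add: tensor_op_def cinner_vec_def cinner_sum_left cinner_scaleC_left Y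
        cinner_cadjoint_left[OF assms(2)])
  also have "\<dots> = cinner \<Phi> ((Y \<otimes>\<^sub>o Z) \<Psi>)"
    by (subst sum.swap) (simp add: tensor_op_def cinner_vec_def cinner_sum_right cinner_scaleC_right)
  finally show "cinner ((cadjoint Y \<otimes>\<^sub>o cadjoint Z) \<Phi>) \<Psi> = cinner \<Phi> ((Y \<otimes>\<^sub>o Z) \<Psi>)" .
qed

lemma outer_ket_tensor_op:
  "(outer (ket g :: ('i, 'g::finite) frame_space) (ket h :: ('j, 'g) frame_space) \<otimes>\<^sub>o B) \<Psi> =
    ket g \<otimes>\<^sub>v B (\<Psi> $ Orientation h)"
proof -
  have "outer (ket g :: ('i, 'g) frame_space) (ket h :: ('j, 'g) frame_space) (axis a 1)
        \<otimes>\<^sub>v B (\<Psi> $ a) =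
      (if a = Orientation h then ket g \<otimes>\<^sub>v B (\<Psi> $ a) else 0)" for a
    by (auto simp: outer_def ket_def cinner_axis_left vec_eq_iff) (auto simp: axis_def)
  then show ?thesis
    by (simp add: tensor_op_def)
qed

lemma frame_change_nth:
  "frame_change U g\<^sub>i g\<^sub>j \<Psi> $ Orientation h = U (h - g\<^sub>i) (\<Psi> $ Orientation (g\<^sub>j + g\<^sub>i - h))"
proof -
  have "frame_change U g\<^sub>i g\<^sub>j \<Psi> $ Orientation h =
      (\<Sum>g\<in>UNIV. if g = h - g\<^sub>i then U g (\<Psi> $ Orientation (g\<^sub>j - g)) else 0)"
    unfolding frame_change_def outer_ket_tensor_op sum_component
    by (rule sum.cong) (auto simp: ket_def axis_def)
  then show ?thesis
    by (simp add: diff_diff_eq2)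
qed

lemma frame_swap_nth: "frame_swap \<Psi> $ Orientation h = \<Psi> $ Orientation h"
proof -
  have "frame_swap \<Psi> $ Orientation h =
      (\<Sum>g\<in>UNIV. if g = h then \<Psi> $ Orientation g else 0)"
    unfolding frame_swap_def outer_ket_tensor_op sum_component
    by (rule sum.cong) (auto simp: ket_def axis_def)
  then show ?thesis
    by simp
qed

lemma frame_unitary_eq_frame_swap_frame_change:
  fixes U :: "'g::{finite, ab_group_add} \<Rightarrow> 's::chilbert_space \<Rightarrow> 's"
    and \<Psi> :: "('j, 'g, 's) frame_system_space"
  shows "frame_unitary U g\<^sub>i g\<^sub>j \<Psi> =
    frame_swap (frame_change U g\<^sub>i g\<^sub>j \<Psi> :: ('i, 'g, 's) frame_system_space)"
proof -
  have "frame_unitary U g\<^sub>i g\<^sub>j \<Psi> $ a =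
      frame_swap (frame_change U g\<^sub>i g\<^sub>j \<Psi> :: ('i, 'g, 's) frame_system_space) $ a" for a
  proof (cases a)
    case (Orientation h)
    have "frame_unitary U g\<^sub>i g\<^sub>j \<Psi> =
        (frame_change U g\<^sub>i g\<^sub>j \<Psi> :: ('j, 'g, 's) frame_system_space)"
      by (simp add: frame_unitary_def frame_change_def add.commute)
    then show ?thesis
      by (simp add: Orientation frame_swap_nth frame_change_nth)
  qed
  then show ?thesis
    by (simp add: vec_eq_iff)
qed

end

theory Submission
  imports Defs
begin

text \<open>
  Write \<open>\<rho>\<^sub>i = |\<psi>\<rangle>\<langle>\<psi>|\<close>, let \<open>\<phi>\<close> be the image of \<open>\<psi>\<close> under the frame unitary, and
  \<open>\<omega> = (1 \<otimes> Z\<^sup>\<dagger>) \<psi>\<close>. The theorem is the unitary freedom of finite ensembles: the components of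
  \<open>\<phi>\<close> and \<open>\<omega>\<close> give the same operator \<open>\<Sum>\<^sub>a |\<phi>\<^sub>a\<rangle>\<langle>\<phi>\<^sub>a| = \<Sum>\<^sub>a |\<omega>\<^sub>a\<rangle>\<langle>\<omega>\<^sub>a|\<close> iff \<open>\<phi> = (W \<otimes> 1) \<omega>\<close>
  for a unitary \<open>W\<close>, which is then \<open>Y\<^sup>\<dagger>\<close>. If the operators agree, the vectors
  \<open>(\<langle>x, \<phi>\<^sub>a\<rangle>)\<^sub>a\<close> and \<open>(\<langle>x, \<omega>\<^sub>a\<rangle>)\<^sub>a\<close>, for \<open>x\<close> among the finitely many components \<open>\<phi>\<^sub>a\<close> and \<open>\<omega>\<^sub>a\<close>,
  have the same Gram matrix. Finite families with the same Gram matrix are related by a product of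
  complex reflections, and no larger set of \<open>x\<close> is needed because \<open>\<phi>\<^sub>a - ((W \<otimes> 1) \<omega>)\<^sub>a\<close> lies in the
  span of these components.
\<close>

section \<open>Unitary operators\<close>

lemma cinner_add_left: "cinner (x + y) (z :: 'a::chilbert_space) = cinner x z + cinner y z"
  using cinner_commute[of "x + y" z] cinner_commute[of x z] cinner_commute[of y z]
  by (simp add: cinner_add_right)

lemma cinner_diff_right: "cinner (x :: 'a::chilbert_space) (y - z) = cinner x y - cinner x z"
  using cinner_add_right[of x "y - z" z] by simp

lemma cinner_diff_left: "cinner (x - y) (z :: 'a::chilbert_space) = cinner x z - cinner y z"
  using cinner_add_left[of "x - y" y z] by simp

lemma cinner_self_eq_0_iff: "cinner x x = 0 \<longleftrightarrow> (x :: 'a::chilbert_space) = 0"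
  by (simp add: cinner_self)

lemma cinner_zero_right [simp]: "cinner (x :: 'a::chilbert_space) 0 = 0"
  using cinner_add_right[of x 0 0] by simp

lemma cinner_ext_right:
  assumes "\<And>z :: 'a::chilbert_space. cinner z x = cinner z y"
  shows "x = y"
  by (rule cinner_ext) (metis assms cinner_commute)

text \<open>An isometry has operator norm at most 1, so boundedness comes from the inner product
  condition.\<close>

lemma unitaryI:
  fixes W :: "'a::chilbert_space \<Rightarrow> 'b::chilbert_space"
  assumes add: "\<And>x y. W (x + y) = W x + W y"
    and scale: "\<And>c x. W (c *\<^sub>C x) = c *\<^sub>C W x"
    and surj: "surj W"
    and inner: "\<And>x y. cinner (W x) (W y) = cinner x y"
  shows "unitary W"
proof -
  have "norm (W x) = norm x" for x
  proof -
    have "complex_of_real ((norm (W x))\<^sup>2) = of_real ((norm x)\<^sup>2)"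
      by (metis cinner_self inner)
    then show ?thesis
      by (simp only: of_real_eq_iff power2_eq_iff_nonneg norm_ge_zero)
  qed
  then have "bounded_linear W"
    by (intro bounded_linear_intro[where K = 1]) (simp_all add: add scale scaleR_scaleC)
  then show ?thesis
    using assms by (auto simp: unitary_def bounded_clinear_def)
qed

lemma unitary_clinear:
  assumes "unitary W"
  shows "W (x + y) = W x + W y" "W (c *\<^sub>C x) = c *\<^sub>C W x" "W (sum f I) = (\<Sum>i\<in>I. W (f i))"
  using assms bounded_linear.axioms(1)[of W] linear_add[of W] linear_sum[of W]
  by (auto simp: unitary_def bounded_clinear_def bounded_linear.linear)

lemma unitary_id: "unitary id"
  by (rule unitaryI) simp_all

lemma unitary_comp:
  assumes "unitary V" "unitary W"
  shows "unitary (V \<circ> W)"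
proof (rule unitaryI)
  show "surj (V \<circ> W)"
    using assms by (intro comp_surj) (simp_all add: unitary_def)
qed (use assms in \<open>simp_all add: unitary_clinear\<close>, simp add: unitary_def)

lemma unitary_inverses:
  assumes "unitary W"
  shows "cadjoint W (W x) = x" "W (cadjoint W y) = y"
  using assms unitary_inj[OF assms] by (auto simp: cadjoint_unitary unitary_def surj_f_inv_f)

lemma unitary_cadjoint:
  assumes "unitary W"
  shows "unitary (cadjoint W)"
proof (rule unitaryI)
  have inj: "u = v" if "W u = W v" for u v
    using unitary_inj[OF assms] that by (rule injD)
  show "cadjoint W (x + y) = cadjoint W x + cadjoint W y" for x y
    by (rule inj) (simp add: assms unitary_clinear unitary_inverses)
  show "cadjoint W (c *\<^sub>C x) = c *\<^sub>C cadjoint W x" for c x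
    by (rule inj) (simp add: assms unitary_clinear unitary_inverses)
  show "surj (cadjoint W)"
    by (metis assms surjI unitary_inverses(1))
  show "cinner (cadjoint W x) (cadjoint W y) = cinner x y" for x y
    by (simp add: assms cinner_cadjoint_left unitary_inverses)
qed

lemma cadjoint_cadjoint:
  assumes "unitary W"
  shows "cadjoint (cadjoint W) = W"
  by (rule cadjoint_eqI) (metis assms cinner_cadjoint_left cinner_commute)

lemma conj_by_outer:
  assumes "unitary W"
  shows "conj_by W (outer x y) = outer (W x) (W y)"
proof -
  have "cinner y (cadjoint W z) = cinner (W y) z" for z
    by (metis assms cinner_cadjoint_left cinner_commute)
  then show ?thesis
    by (simp add: conj_by_def outer_def fun_eq_iff assms unitary_clinear)
qed

lemma conj_by_adj_outer:
  assumes "unitary W"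
  shows "conj_by_adj W (outer x y) = outer (cadjoint W x) (cadjoint W y)"
  by (simp add: conj_by_adj_def outer_def fun_eq_iff cinner_cadjoint_left assms
      unitary_clinear[OF unitary_cadjoint])

section \<open>Complex reflections and Gram matrices\<close>

text \<open>\<open>R\<close> fixes the complement of \<open>v = x - y\<close> and multiplies
  \<open>v\<close> by a phase. The real reflection, with factor -1, sends \<open>x\<close> to
  \<open>y\<close> only when \<open>cinner x y\<close> is real; for \<open>p \<noteq> 0\<close> the
  right phase is \<open>- cnj p / p\<close>.\<close>

lemma complex_reflection:
  fixes x y :: "'a::chilbert_space"
  assumes "cinner x x = cinner y y"
  shows "\<exists>R :: 'a \<Rightarrow> 'a. unitary R \<and> R x = y \<and> (\<forall>z. cinner (x - y) z = 0 \<longrightarrow> R z = z)"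
proof -
  define v where "v = x - y"
  define p where "p = cinner v x"
  define k where "k = - 1 / p" \<comment> \<open>\<open>p = 0\<close> only for \<open>x = y\<close>, and then \<open>R = id\<close>\<close>
  define R where "R c z = z + (c * cinner v z) *\<^sub>C v" for c z
  have vv: "cinner v v = p + cnj p"
    using assms cinner_commute[of x v]
    by (simp add: p_def v_def cinner_diff_left cinner_diff_right)
  have v0: "v = 0" if "p = 0"
    using vv that by (simp add: cinner_self_eq_0_iff)
  \<comment> \<open>For \<open>v \<noteq> 0\<close> this says that the factor
    \<open>1 + k * cinner v v\<close> on \<open>v\<close> has modulus 1.\<close>
  have k: "k * cnj k * cinner v v = - k - cnj k"
    by (cases "p = 0") (simp_all add: k_def vv field_simps)
  \<comment> \<open>\<open>R (cnj c)\<close> is the adjoint of \<open>R c\<close>. The explicit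
    inverse gives surjectivity, which isometry alone does not in infinite dimension.\<close>
  have inverse: "R (cnj c) (R c z) = z" if "c * cnj c * cinner v v = - c - cnj c" for c z
  proof -
    have "c * cinner v z + cnj c * (cinner v z + c * cinner v z * cinner v v) =
        cinner v z * (c + cnj c + c * cnj c * cinner v v)"
      by (simp add: algebra_simps)
    then have "(c * cinner v z) *\<^sub>C v + (cnj c * (cinner v z + c * cinner v z * cinner v v)) *\<^sub>C v = 0"
      by (simp add: that flip: scaleC_add_left)
    then show ?thesis
      by (simp add: R_def cinner_add_right cinner_scaleC_right add.assoc)
  qed
  have "unitary (R k)"
  proof (rule unitaryI)
    show "R k (z + w) = R k z + R k w" for z w
      by (simp add: R_def cinner_add_right scaleC_add_left distrib_left add_ac)
    show "R k (c *\<^sub>C z) = c *\<^sub>C R k z" for c z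
      by (simp add: R_def cinner_scaleC_right scaleC_add_right scaleC_scaleC mult_ac)
    show "surj (R k)"
    proof (rule surjI)
      show "R k (R (cnj k) z) = z" for z
        using inverse[of "cnj k" z] k by (simp add: mult.commute)
    qed
    show "cinner (R k z) (R k w) = cinner z w" for z w
    proof -
      have "cinner (R k z) (R k w) =
          cinner z w + cinner z v * cinner v w * (k + cnj k + k * cnj k * cinner v v)"
        using cinner_commute[of z v]
        by (simp add: R_def cinner_add_left cinner_add_right cinner_scaleC_left
            cinner_scaleC_right algebra_simps)
      then show ?thesis
        by (simp add: k)
    qed
  qed
  moreover have "R k x = y"
  proof (cases "p = 0")
    case True
    then show ?thesis
      using v0 by (simp add: R_def v_def)
  next
    case False
    then have "R k x = x + (- 1) *\<^sub>C v"
      by (simp add: R_def k_def flip: p_def)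
    also have "\<dots> = y"
      using scaleR_scaleC[of "-1" v, symmetric] by (simp add: v_def)
    finally show ?thesis .
  qed
  moreover have "R k z = z" if "cinner (x - y) z = 0" for z
    using that by (simp add: R_def v_def)
  ultimately show ?thesis
    by blast
qed

text \<open>Induction on \<open>S\<close>: the unitary found so far is followed by a reflection that
  corrects the new vector and leaves those already matched in place.\<close>

lemma unitary_of_equal_Gram:
  fixes f h :: "'b \<Rightarrow> 'a::chilbert_space"
  assumes "finite S" and "\<And>x y. x \<in> S \<Longrightarrow> y \<in> S \<Longrightarrow> cinner (f x) (f y) = cinner (h x) (h y)"
  shows "\<exists>W :: 'a \<Rightarrow> 'a. unitary W \<and> (\<forall>x\<in>S. W (f x) = h x)"
  using assms
proof (induction S)
  case empty
  then show ?case
    using unitary_id by blast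
next
  case (insert a S)
  then obtain W :: "'a \<Rightarrow> 'a" where W: "unitary W" "\<And>x. x \<in> S \<Longrightarrow> W (f x) = h x"
    by auto
  have W_inner: "cinner (W x) (W y) = cinner x y" for x y
    using W(1) by (simp add: unitary_def)
  obtain R :: "'a \<Rightarrow> 'a" where R: "unitary R" "R (W (f a)) = h a"
    "\<And>z. cinner (W (f a) - h a) z = 0 \<Longrightarrow> R z = z"
    using complex_reflection[of "W (f a)" "h a"] insert.prems W_inner by auto
  have "R (W (f x)) = h x" if "x \<in> S" for x
  proof -
    \<comment> \<open>Both sides equal \<open>cinner (f a) (f x)\<close>, so \<open>h x\<close> is
      orthogonal to \<open>W (f a) - h a\<close> and \<open>R\<close> fixes it.\<close>
    have "cinner (W (f a)) (h x) = cinner (h a) (h x)"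
      using W_inner[of "f a" "f x"] W(2) insert.prems that by simp
    then show ?thesis
      using R(3)[of "h x"] W(2) that by (simp add: cinner_diff_left)
  qed
  then show ?case
    using R(2) W(2) unitary_comp[OF R(1) W(1)] by (intro exI[of _ "R \<circ> W"]) (auto simp: o_def)
qed

section \<open>Tensor products and partial traces\<close>

lemma cinner_tensor_vec:
  "cinner (\<phi> \<otimes>\<^sub>v x) (\<psi> \<otimes>\<^sub>v y) = cinner \<phi> \<psi> * cinner x y"
  by (simp add: cinner_vec_def cinner_scaleC_left cinner_scaleC_right cinner_complex_def
      sum_distrib_left sum_distrib_right mult_ac)

lemma tensor_vec_add_right: "\<phi> \<otimes>\<^sub>v (x + y) = \<phi> \<otimes>\<^sub>v x + \<phi> \<otimes>\<^sub>v y"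
  by (simp add: vec_eq_iff scaleC_add_right)

lemma tensor_vec_scaleC_right: "\<phi> \<otimes>\<^sub>v (c *\<^sub>C x) = c *\<^sub>C (\<phi> \<otimes>\<^sub>v x)"
  by (simp add: vec_eq_iff scaleC_vec_def scaleC_scaleC mult.commute)

lemma scaleC_sum_right: "c *\<^sub>C (\<Sum>i\<in>I. f i) = (\<Sum>i\<in>I. c *\<^sub>C (f i :: 'a::chilbert_space))"
  by (induction I rule: infinite_finite_induct) (simp_all add: scaleC_add_right)

lemma vec_eq_sum_tensor_vec: "\<Psi> = (\<Sum>a\<in>UNIV. axis a 1 \<otimes>\<^sub>v (\<Psi> $ a))"
proof -
  have "(axis a 1 \<otimes>\<^sub>v (\<Psi> $ a)) $ b = (if a = b then \<Psi> $ a else 0)" for a b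
    by (simp add: axis_def)
  then show ?thesis
    by (simp add: vec_eq_iff)
qed

lemma unitary_tensor_op:
  fixes Y :: "complex ^ 'a \<Rightarrow> complex ^ 'b" and Z :: "'s::chilbert_space \<Rightarrow> 't::chilbert_space"
  assumes Y: "unitary Y" and Z: "unitary Z"
  shows "unitary (Y \<otimes>\<^sub>o Z)"
proof (rule unitaryI)
  show add: "(Y \<otimes>\<^sub>o Z) (\<Psi> + \<Phi>) = (Y \<otimes>\<^sub>o Z) \<Psi> + (Y \<otimes>\<^sub>o Z) \<Phi>" for \<Psi> \<Phi>
    by (simp add: tensor_op_def Z unitary_clinear tensor_vec_add_right sum.distrib)
  show "(Y \<otimes>\<^sub>o Z) (c *\<^sub>C \<Psi>) = c *\<^sub>C (Y \<otimes>\<^sub>o Z) \<Psi>" for c \<Psi>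
    unfolding scaleC_sum_right tensor_op_def
    by (simp add: scaleC_vec_def[of c \<Psi>] Z unitary_clinear tensor_vec_scaleC_right)
  have zero: "(Y \<otimes>\<^sub>o Z) 0 = 0"
    using add[of 0 0] by simp
  have sum: "(Y \<otimes>\<^sub>o Z) (\<Sum>i\<in>I. F i) = (\<Sum>i\<in>I. (Y \<otimes>\<^sub>o Z) (F i))" for I :: "'b set" and F
    by (induction I rule: infinite_finite_induct) (simp_all add: add zero)
  have product: "(Y \<otimes>\<^sub>o Z) (\<phi> \<otimes>\<^sub>v x) = Y \<phi> \<otimes>\<^sub>v Z x" for \<phi> x
    using Y Z by (intro tensor_op_tensor_vec) (auto simp: unitary_def)
  \<comment> \<open>The preimage is a sum of product vectors, on which the two factors are inverted
    separately.\<close>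
  have "(Y \<otimes>\<^sub>o Z) (\<Sum>b\<in>UNIV. cadjoint Y (axis b 1) \<otimes>\<^sub>v cadjoint Z (\<Psi> $ b)) = \<Psi>" for \<Psi>
    unfolding sum product unitary_inverses(2)[OF Y] unitary_inverses(2)[OF Z]
    by (rule vec_eq_sum_tensor_vec[symmetric])
  then show "surj (Y \<otimes>\<^sub>o Z)"
    by (rule surjI)
  show "cinner ((Y \<otimes>\<^sub>o Z) \<Psi>) ((Y \<otimes>\<^sub>o Z) \<Phi>) = cinner \<Psi> \<Phi>" for \<Psi> \<Phi>
  proof -
    have "cinner (Y (axis a 1)) (Y (axis b 1)) * cinner (Z (\<Psi> $ a)) (Z (\<Phi> $ b)) =
        (if a = b then cinner (\<Psi> $ a) (\<Phi> $ b) else 0)" for a b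
      using Y Z by (simp add: unitary_def cinner_axis_left) (simp add: axis_def)
    then show ?thesis
      by (simp add: tensor_op_def cinner_sum_left cinner_sum_right cinner_tensor_vec
          cinner_vec_def[of \<Psi>])
  qed
qed

section \<open>Reduced operators of pure states\<close>

lemma partial_trace_outer:
  "partial_trace (outer \<phi> \<phi>) x = (\<Sum>a\<in>UNIV. cinner (\<phi> $ a) x *\<^sub>C (\<phi> $ a))"
proof -
  have "cinner \<phi> (axis a 1 \<otimes>\<^sub>v x) = cinner (\<phi> $ a) x" for a
  proof -
    have "cinner \<phi> (axis a 1 \<otimes>\<^sub>v x) = (\<Sum>b\<in>UNIV. if b = a then cinner (\<phi> $ b) x else 0)"
      unfolding cinner_vec_def by (rule sum.cong) (auto simp: axis_def)
    then show ?thesis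
      by simp
  qed
  then show ?thesis
    by (simp add: partial_trace_def outer_def scaleC_vec_def)
qed

text \<open>The partial inner product \<open>(1 \<otimes> \<langle>x|) \<phi>\<close>, a vector of
  the finite-dimensional frame factor.\<close>

definition overlaps :: "'s::chilbert_space ^ 'a \<Rightarrow> 's \<Rightarrow> complex ^ 'a"
  where "overlaps \<phi> x = (\<chi> a. cinner x (\<phi> $ a))"

text \<open>The reduced operator and the Gram matrix of the overlap vectors thus determine each
  other. The arguments change places because \<open>overlaps \<phi>\<close> is
  conjugate-linear.\<close>

lemma cinner_partial_trace_outer:
  "cinner y (partial_trace (outer \<phi> \<phi>) x) = cinner (overlaps \<phi> x) (overlaps \<phi> y)"
proof -
  have "cinner (\<phi> $ a) x = cnj (cinner x (\<phi> $ a))" for a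
    by (rule cinner_commute)
  then show ?thesis
    by (simp add: partial_trace_outer cinner_sum_right cinner_scaleC_right overlaps_def
        cinner_vec_def cinner_complex_def)
qed

text \<open>\<open>W\<close> acts on the frame and the pairing with \<open>x\<close> on the system,
  so the two commute.\<close>

lemma overlaps_tensor_op_id:
  assumes "unitary W"
  shows "overlaps ((W \<otimes>\<^sub>o id) \<omega>) x = W (overlaps \<omega> x)"
proof -
  have "overlaps \<omega> x = (\<Sum>b\<in>UNIV. cinner x (\<omega> $ b) *\<^sub>C axis b 1)"
    by (simp add: overlaps_def vec_eq_iff scaleC_vec_def scaleC_complex_def axis_def if_distrib
        cong: if_cong)
  then have "W (overlaps \<omega> x) = (\<Sum>b\<in>UNIV. cinner x (\<omega> $ b) *\<^sub>C W (axis b 1))"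
    by (simp only: unitary_clinear[OF assms])
  then show ?thesis
    by (simp add: overlaps_def tensor_op_def vec_eq_iff cinner_sum_right cinner_scaleC_right
        scaleC_vec_def scaleC_complex_def mult.commute)
qed

text \<open>Purifications with the same ancilla, here the frame factor, agree up to a unitary of the
  ancilla; conversely, such a unitary preserves the Gram matrices of overlap vectors.\<close>

lemma partial_trace_outer_eq_iff:
  fixes \<phi> \<omega> :: "'s::chilbert_space ^ 'a"
  shows "partial_trace (outer \<phi> \<phi>) = partial_trace (outer \<omega> \<omega>) \<longleftrightarrow>
    (\<exists>W. unitary W \<and> \<phi> = (W \<otimes>\<^sub>o id) \<omega>)"
proof (intro iffI)
  assume eq: "partial_trace (outer \<phi> \<phi>) = partial_trace (outer \<omega> \<omega>)"
  let ?S = "range (($) \<phi>) \<union> range (($) \<omega>)"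
  have "cinner (overlaps \<omega> x) (overlaps \<omega> y) = cinner (overlaps \<phi> x) (overlaps \<phi> y)" for x y
    by (metis cinner_partial_trace_outer eq)
  then obtain W :: "complex ^ 'a \<Rightarrow> complex ^ 'a"
    where W: "unitary W" "\<forall>x\<in>?S. W (overlaps \<omega> x) = overlaps \<phi> x"
    using unitary_of_equal_Gram[of ?S "overlaps \<omega>" "overlaps \<phi>"] by auto
  define \<eta> where "\<eta> = (W \<otimes>\<^sub>o id) \<omega>"
  have overlaps_\<eta>: "overlaps \<eta> x = overlaps \<phi> x" if "x \<in> ?S" for x
    using W(2) that unfolding \<eta>_def overlaps_tensor_op_id[OF W(1)] by blast
  have orth: "cinner x (\<phi> $ a - \<eta> $ a) = 0" if "x \<in> ?S" for x a
    using overlaps_\<eta>[OF that] by (simp add: overlaps_def vec_eq_iff cinner_diff_right)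
  have "\<phi> $ a = \<eta> $ a" for a
  proof -
    \<comment> \<open>As a combination of components of \<omega>, \<open>\<eta> $ a\<close> is
      orthogonal to the difference \<open>\<phi> $ a - \<eta> $ a\<close>, which is therefore
      orthogonal to itself.\<close>
    have "\<eta> $ a = (\<Sum>b\<in>UNIV. (W (axis b 1) $ a) *\<^sub>C (\<omega> $ b))"
      by (simp add: \<eta>_def tensor_op_def)
    then have "cinner (\<eta> $ a) z = (\<Sum>b\<in>UNIV. cnj (W (axis b 1) $ a) * cinner (\<omega> $ b) z)" for z
      by (simp add: cinner_sum_left cinner_scaleC_left)
    then have "cinner (\<eta> $ a) (\<phi> $ a - \<eta> $ a) = 0"
      by (simp add: orth)
    moreover have "cinner (\<phi> $ a) (\<phi> $ a - \<eta> $ a) = 0"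
      by (simp add: orth)
    ultimately have "cinner (\<phi> $ a - \<eta> $ a) (\<phi> $ a - \<eta> $ a) = 0"
      by (simp only: cinner_diff_left[of "\<phi> $ a"] diff_self)
    then show ?thesis
      by (simp add: cinner_self_eq_0_iff)
  qed
  then show "\<exists>W. unitary W \<and> \<phi> = (W \<otimes>\<^sub>o id) \<omega>"
    using W(1) by (auto simp: vec_eq_iff \<eta>_def)
next
  assume "\<exists>W. unitary W \<and> \<phi> = (W \<otimes>\<^sub>o id) \<omega>"
  then obtain W :: "complex ^ 'a \<Rightarrow> complex ^ 'a" where "unitary W" "\<phi> = (W \<otimes>\<^sub>o id) \<omega>"
    by blast
  then have "cinner (overlaps \<phi> x) (overlaps \<phi> y) = cinner (overlaps \<omega> x) (overlaps \<omega> y)" for x y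
    by (simp add: overlaps_tensor_op_id unitary_def)
  then have "cinner y (partial_trace (outer \<phi> \<phi>) x) = cinner y (partial_trace (outer \<omega> \<omega>) x)" for x y
    by (simp only: cinner_partial_trace_outer)
  then show "partial_trace (outer \<phi> \<phi>) = partial_trace (outer \<omega> \<omega>)"
    by (metis cinner_ext_right ext)
qed

lemma conj_by_adj_partial_trace_outer:
  assumes "unitary Z"
  shows "conj_by_adj Z (partial_trace (outer \<psi> \<psi>)) =
    partial_trace (outer (\<chi> a. cadjoint Z (\<psi> $ a)) (\<chi> a. cadjoint Z (\<psi> $ a)))"
  by (simp add: fun_eq_iff conj_by_adj_def partial_trace_outer cinner_cadjoint_left assms
      unitary_clinear[OF unitary_cadjoint])

section \<open>Frame changes\<close>

text \<open>In components, the map permutes the group by the involution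
  \<open>h \<mapsto> g\<^sub>j + g\<^sub>i - h\<close> and applies a unitary of the system to each
  entry.\<close>

lemma unitary_frame_change:
  fixes U :: "'g::{finite, ab_group_add} \<Rightarrow> 's::chilbert_space \<Rightarrow> 's"
  assumes "unitary_rep U"
  shows "unitary (frame_change U g\<^sub>i g\<^sub>j ::
    ('j, 'g, 's) frame_system_space \<Rightarrow> ('i, 'g, 's) frame_system_space)"
    (is "unitary ?V")
proof (rule unitaryI)
  have U: "unitary (U g)" for g
    using assms by (simp add: unitary_rep_def)
  have vec_eqI: "\<Psi> = \<Phi>" if "\<And>h. \<Psi> $ Orientation h = \<Phi> $ Orientation h"
    for \<Psi> \<Phi> :: "('r, 'g, 's) frame_system_space"
    unfolding vec_eq_iff by (metis orientation.exhaust that)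
  have sum_eq: "(\<Sum>a\<in>UNIV. F a) = (\<Sum>h\<in>UNIV. F (Orientation h))"
    for F :: "('r, 'g) orientation \<Rightarrow> complex"
    by (rule sum.reindex_bij_witness[where j = orient and i = Orientation]) simp_all
  show "?V (\<Psi> + \<Phi>) = ?V \<Psi> + ?V \<Phi>" for \<Psi> \<Phi>
    by (rule vec_eqI) (simp add: frame_change_nth U unitary_clinear)
  show "?V (c *\<^sub>C \<Psi>) = c *\<^sub>C ?V \<Psi>" for c \<Psi>
    by (rule vec_eqI) (simp add: frame_change_nth scaleC_vec_def U unitary_clinear)
  show "surj ?V"
  proof (rule surjI)
    fix \<Phi> :: "('i, 'g, 's) frame_system_space"
    \<comment> \<open>At \<open>orient a = g\<^sub>j + g\<^sub>i - h\<close> the group element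
      \<open>h - g\<^sub>i\<close> reads \<open>g\<^sub>j - orient a\<close>.\<close>
    show "?V (\<chi> a. cadjoint (U (g\<^sub>j - orient a)) (\<Phi> $ Orientation (g\<^sub>j + g\<^sub>i - orient a))) = \<Phi>"
      by (rule vec_eqI) (simp add: frame_change_nth U unitary_inverses algebra_simps)
  qed
  show "cinner (?V \<Psi>) (?V \<Phi>) = cinner \<Psi> \<Phi>" for \<Psi> \<Phi>
  proof -
    have "cinner (?V \<Psi>) (?V \<Phi>) =
        (\<Sum>h\<in>UNIV. cinner (\<Psi> $ Orientation (g\<^sub>j + g\<^sub>i - h)) (\<Phi> $ Orientation (g\<^sub>j + g\<^sub>i - h)))"
      unfolding cinner_vec_def sum_eq using U by (simp add: frame_change_nth unitary_def)
    also have "\<dots> = (\<Sum>h\<in>UNIV. cinner (\<Psi> $ Orientation h) (\<Phi> $ Orientation h))"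
      by (rule sum.reindex_bij_witness[where i = "\<lambda>h. g\<^sub>j + g\<^sub>i - h" and j = "\<lambda>h. g\<^sub>j + g\<^sub>i - h"])
        simp_all
    also have "\<dots> = cinner \<Psi> \<Phi>"
      unfolding cinner_vec_def sum_eq ..
    finally show ?thesis .
  qed
qed

text \<open>With both frame labels equal, the frame change is the frame unitary itself.\<close>

lemma unitary_frame_unitary:
  fixes U :: "'g::{finite, ab_group_add} \<Rightarrow> 's::chilbert_space \<Rightarrow> 's"
  assumes "unitary_rep U"
  shows "unitary (frame_unitary U g\<^sub>i g\<^sub>j :: ('j, 'g, 's) frame_system_space \<Rightarrow> _)"
proof -
  have "(frame_unitary U g\<^sub>i g\<^sub>j :: ('j, 'g, 's) frame_system_space \<Rightarrow> _) = frame_change U g\<^sub>i g\<^sub>j"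
    by (simp add: fun_eq_iff frame_unitary_def frame_change_def add.commute)
  then show ?thesis
    using unitary_frame_change[OF assms, where 'i = 'j and 'j = 'j, of g\<^sub>i g\<^sub>j] by simp
qed

text \<open>The swap only relabels the frame index, and the trace sums over that index.\<close>

lemma partial_trace_outer_frame_swap:
  fixes \<Phi> :: "('i, 'g::{finite, ab_group_add}, 's::chilbert_space) frame_system_space"
  shows "partial_trace (outer (frame_swap \<Phi> :: ('j, 'g, 's) frame_system_space) (frame_swap \<Phi>)) =
    partial_trace (outer \<Phi> \<Phi>)"
proof
  fix x
  have swap_nth: "(frame_swap \<Phi> :: ('j, 'g, 's) frame_system_space) $ a = \<Phi> $ Orientation (orient a)" for a
    by (cases a) (simp add: frame_swap_nth)
  have "(\<Sum>a\<in>UNIV. cinner ((frame_swap \<Phi> :: ('j, 'g, 's) frame_system_space) $ a) x *\<^sub>C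
      ((frame_swap \<Phi> :: ('j, 'g, 's) frame_system_space) $ a)) =
      (\<Sum>a\<in>UNIV. cinner (\<Phi> $ a) x *\<^sub>C (\<Phi> $ a))"
    by (rule sum.reindex_bij_witness[where j = "Orientation \<circ> orient" and i = "Orientation \<circ> orient"])
      (simp_all add: swap_nth)
  then show "partial_trace (outer (frame_swap \<Phi> :: ('j, 'g, 's) frame_system_space) (frame_swap \<Phi>)) x =
      partial_trace (outer \<Phi> \<Phi>) x"
    by (simp add: partial_trace_outer)
qed

theorem theorem4:
  fixes U :: "'g::{finite, ab_group_add} \<Rightarrow> 's::chilbert_space \<Rightarrow> 's"
    and g\<^sub>i g\<^sub>j :: 'g
    and \<rho>\<^sub>i :: "('j, 'g, 's) frame_system_space \<Rightarrow> ('j, 'g, 's) frame_system_space"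
    and \<rho>\<^sub>j :: "('i, 'g, 's) frame_system_space \<Rightarrow> ('i, 'g, 's) frame_system_space"
  assumes "CARD('g) > 1"
    and "unitary_rep U"
    and "pure_state \<rho>\<^sub>i"
    and "\<rho>\<^sub>j = conj_by (frame_change U g\<^sub>i g\<^sub>j) \<rho>\<^sub>i"
  shows "((\<exists>Z. unitary Z \<and> partial_trace \<rho>\<^sub>j = conj_by_adj Z (partial_trace \<rho>\<^sub>i)) \<longleftrightarrow>
      (\<exists>Z Y. unitary Z \<and> unitary Y \<and> \<rho>\<^sub>i \<in> invariant_subalgebra U g\<^sub>i g\<^sub>j (Y \<otimes>\<^sub>o Z))) \<and>
    (\<forall>Z. unitary Z \<longrightarrow>
      (partial_trace \<rho>\<^sub>j = conj_by_adj Z (partial_trace \<rho>\<^sub>i) \<longleftrightarrow>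
        (\<exists>Y. unitary Y \<and> \<rho>\<^sub>i \<in> invariant_subalgebra U g\<^sub>i g\<^sub>j (Y \<otimes>\<^sub>o Z))))"
proof -
  \<comment> \<open>The equivalence is proved for each fixed \<open>Z\<close>; quantifying over
    \<open>Z\<close> gives the other conjunct.\<close>
  have local: "partial_trace \<rho>\<^sub>j = conj_by_adj Z (partial_trace \<rho>\<^sub>i) \<longleftrightarrow>
      (\<exists>Y. unitary Y \<and> \<rho>\<^sub>i \<in> invariant_subalgebra U g\<^sub>i g\<^sub>j (Y \<otimes>\<^sub>o Z))"
    if Z: "unitary Z" for Z
  proof -
    obtain \<psi> where \<rho>\<^sub>i: "bounded_clinear \<rho>\<^sub>i" "\<rho>\<^sub>i = outer \<psi> \<psi>"
      using assms(3) by (auto simp: pure_state_def density_operators_def)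
    define \<phi> where "\<phi> = frame_unitary U g\<^sub>i g\<^sub>j \<psi>"
    define \<omega> where "\<omega> = (\<chi> a. cadjoint Z (\<psi> $ a))"
    have "partial_trace \<rho>\<^sub>j = partial_trace (outer \<phi> \<phi>)"
      using unitary_frame_change[OF assms(2), where 'i = 'i and 'j = 'j, of g\<^sub>i g\<^sub>j]
      by (simp add: assms(4) \<rho>\<^sub>i(2) conj_by_outer \<phi>_def partial_trace_outer_frame_swap
          frame_unitary_eq_frame_swap_frame_change[where 'i = 'i])
    moreover have "conj_by_adj Z (partial_trace \<rho>\<^sub>i) = partial_trace (outer \<omega> \<omega>)"
      by (simp add: \<rho>\<^sub>i(2) \<omega>_def conj_by_adj_partial_trace_outer Z)
    moreover have "\<rho>\<^sub>i \<in> invariant_subalgebra U g\<^sub>i g\<^sub>j (Y \<otimes>\<^sub>o Z) \<longleftrightarrow>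
        outer \<phi> \<phi> = outer ((cadjoint Y \<otimes>\<^sub>o id) \<omega>) ((cadjoint Y \<otimes>\<^sub>o id) \<omega>)" if "unitary Y" for Y
    proof -
      \<comment> \<open>Factor \<open>Y\<^sup>\<dagger> \<otimes> Z\<^sup>\<dagger>\<close> as
        \<open>(Y\<^sup>\<dagger> \<otimes> 1) (1 \<otimes> Z\<^sup>\<dagger>)\<close>.\<close>
      have "(cadjoint Y \<otimes>\<^sub>o cadjoint Z) \<psi> = (cadjoint Y \<otimes>\<^sub>o id) \<omega>"
        by (simp add: tensor_op_def \<omega>_def)
      moreover have "conj_by (frame_unitary U g\<^sub>i g\<^sub>j) \<rho>\<^sub>i = outer \<phi> \<phi>"
        unfolding \<rho>\<^sub>i(2) \<phi>_def by (intro conj_by_outer unitary_frame_unitary assms(2))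
      ultimately show ?thesis
        using \<rho>\<^sub>i(1) unfolding invariant_subalgebra_def
        by (simp add: \<rho>\<^sub>i(2) conj_by_adj_outer unitary_tensor_op cadjoint_tensor_op that Z)
    qed
    moreover have "partial_trace (outer \<phi> \<phi>) = partial_trace (outer \<omega> \<omega>) \<longleftrightarrow>
        (\<exists>Y. unitary Y \<and> outer \<phi> \<phi> = outer ((cadjoint Y \<otimes>\<^sub>o id) \<omega>) ((cadjoint Y \<otimes>\<^sub>o id) \<omega>))"
    proof
      assume "partial_trace (outer \<phi> \<phi>) = partial_trace (outer \<omega> \<omega>)"
      then show "\<exists>Y. unitary Y \<and> outer \<phi> \<phi> = outer ((cadjoint Y \<otimes>\<^sub>o id) \<omega>) ((cadjoint Y \<otimes>\<^sub>o id) \<omega>)"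
        unfolding partial_trace_outer_eq_iff by (metis cadjoint_cadjoint unitary_cadjoint)
    next
      \<comment> \<open>Equal projectors fix the vectors only up to a phase. Taking partial traces
        of both projectors avoids it, since \<open>cadjoint Y\<close> on the frame leaves the
        reduced operator of \<omega> unchanged.\<close>
      assume "\<exists>Y. unitary Y \<and> outer \<phi> \<phi> = outer ((cadjoint Y \<otimes>\<^sub>o id) \<omega>) ((cadjoint Y \<otimes>\<^sub>o id) \<omega>)"
      then show "partial_trace (outer \<phi> \<phi>) = partial_trace (outer \<omega> \<omega>)"
        by (metis partial_trace_outer_eq_iff unitary_cadjoint)
    qed
    ultimately show ?thesis
      by auto
  qed
  then show ?thesis
    by blast
qed

end
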